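(* Let $({\bf v}_n)_{n\ge 0}$ be a sequence in $\mathbb{R}^2$ generated by the non-ideal iterative rule with restitution coefficient $\varepsilon\in[0,1)$ (defined in the context) from some ${\bf v}_0\in\mathbb{R}^2$. For every $n\ge 0$, if ${\bf v}_n\in\mathcal{Z}_{12}$ then ${\bf v}_{n+1}\notin\mathcal{Z}_{12}$.
   Context: A rigid disk is simultaneously in contact with two walls forming a corner of angle $2\alpha\in(0,\pi)$; put $k=\tan\alpha>0$. Let $\varepsilon\in[0,1)$ be a restitution coefficient. The linear velocity of the disk is a pair $(\dot x,\dot y)\in\mathbb{R}^2$. The plane of velocities is partitioned into four zones: $\mathcal{Z}_0=\{k\dot x+\dot y\le 0,\ k\dot x-\dot y\le 0\}$ (exit velocities), $\mathcal{Z}_1=\{k\dot x+\dot y\le 0,\ k\dot x-\dot y>0\}$ (impact with the first wall only), $\mathcal{Z}_2=\{k\dot x+\dot y>0,\ k\dot x-\dot y\le 0\}$ (impact with the second wall only), $\mathcal{Z}_{12}=\{k\dot x+\dot y>0,\ k\dot x-\dot y>0\}$ (multiple impact). Non-ideal iterative rule. Given ${\bf v}_n=(\dot x_n,\dot y_n)$, define ${\bf v}_{n+1}=(\dot x_{n+1},\dot y_{n+1})$ by: - if ${\bf v}_n\in\mathcal{Z}_0$: ${\bf v}_{n+1}={\bf v}_n$; - if ${\bf v}_n\in\mathcal{Z}_1$: $\dot x_{n+1}=\frac{1-\varepsilon k^2}{1+k^2}\dot x_n+\frac{(1+\varepsilon)k}{1+k^2}\dot y_n$, $\ \dot y_{n+1}=\frac{(1+\varepsilon)k}{1+k^2}\dot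 x_n-\frac{\varepsilon-k^2}{1+k^2}\dot y_n$; - if ${\bf v}_n\in\mathcal{Z}_2$: $\dot x_{n+1}=\frac{1-\varepsilon k^2}{1+k^2}\dot x_n-\frac{(1+\varepsilon)k}{1+k^2}\dot y_n$, $\ \dot y_{n+1}=-\frac{(1+\varepsilon)k}{1+k^2}\dot x_n-\frac{\varepsilon-k^2}{1+k^2}\dot y_n$; - if ${\bf v}_n\in\mathcal{Z}_{12}$: $\dot x_{n+1}=\frac{-\varepsilon k^4\dot x_n^2+(1-(1+\varepsilon)k^2)\dot y_n^2}{k^4\dot x_n^2+\dot y_n^2}\,\dot x_n$, $\ \dot y_{n+1}=\frac{k^2(k^2-(1+\varepsilon))\dot x_n^2-\varepsilon\dot y_n^2}{k^4\dot x_n^2+\dot y_n^2}\,\dot y_n$. *)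

theory Defs
  imports Complex_Main
begin

definition zone0 :: "real \<Rightarrow> (real \<times> real) set" where
  "zone0 k = {(x, y). k * x + y \<le> 0 \<and> k * x - y \<le> 0}"

definition zone1 :: "real \<Rightarrow> (real \<times> real) set" where
  "zone1 k = {(x, y). k * x + y \<le> 0 \<and> k * x - y > 0}"

definition zone2 :: "real \<Rightarrow> (real \<times> real) set" where
  "zone2 k = {(x, y). k * x + y > 0 \<and> k * x - y \<le> 0}"

definition zone12 :: "real \<Rightarrow> (real \<times> real) set" where
  "zone12 k = {(x, y). k * x + y > 0 \<and> k * x - y > 0}"

lemma zones_cover: "zone0 k \<union> zone1 k \<union> zone2 k \<union> zone12 k = UNIV"
  by (auto simp: zone0_def zone1_def zone2_def zone12_def)

lemma zones_disjoint:
  "zone0 k \<inter> zone1 k = {}" "zone0 k \<inter> zone2 k = {}" "zone0 k \<inter> zone12 k = {}"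
  "zone1 k \<inter> zone2 k = {}" "zone1 k \<inter> zone12 k = {}" "zone2 k \<inter> zone12 k = {}"
  by (auto simp: zone0_def zone1_def zone2_def zone12_def)

definition impact1 :: "real \<Rightarrow> real \<Rightarrow> real \<times> real \<Rightarrow> real \<times> real" where
  "impact1 e k = (\<lambda>(x, y).
     ((1 - e * k^2) / (1 + k^2) * x + (1 + e) * k / (1 + k^2) * y,
      (1 + e) * k / (1 + k^2) * x - (e - k^2) / (1 + k^2) * y))"

definition impact2 :: "real \<Rightarrow> real \<Rightarrow> real \<times> real \<Rightarrow> real \<times> real" where
  "impact2 e k = (\<lambda>(x, y).
     ((1 - e * k^2) / (1 + k^2) * x - (1 + e) * k / (1 + k^2) * y,
      - ((1 + e) * k / (1 + k^2)) * x - (e - k^2) / (1 + k^2) * y))"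

text \<open>On \<open>zone12 k\<close> with \<open>k > 0\<close> one has \<open>x > 0\<close>, so the denominator does not vanish.\<close>

definition impact12 :: "real \<Rightarrow> real \<Rightarrow> real \<times> real \<Rightarrow> real \<times> real" where
  "impact12 e k = (\<lambda>(x, y).
     ((- e * k^4 * x^2 + (1 - (1 + e) * k^2) * y^2) / (k^4 * x^2 + y^2) * x,
      (k^2 * (k^2 - (1 + e)) * x^2 - e * y^2) / (k^4 * x^2 + y^2) * y))"

text \<open>By \<open>zones_cover\<close> and \<open>zones_disjoint\<close>, the final branch applies exactly on \<open>zone12 k\<close>
  and the order of the tests is immaterial.\<close>

definition impact_step :: "real \<Rightarrow> real \<Rightarrow> real \<times> real \<Rightarrow> real \<times> real" where
  "impact_step e k v =
     (if v \<in> zone0 k then v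
      else if v \<in> zone1 k then impact1 e k v
      else if v \<in> zone2 k then impact2 e k v
      else impact12 e k v)"

end

theory Submission
  imports Defs
begin

text \<open>
  Multiply the outgoing velocity \<open>(x', y')\<close> of a multiple impact by the positive denominator
  \<open>D = k\<^sup>4 x\<^sup>2 + y\<^sup>2\<close>. Since rule and zone are symmetric under \<open>y \<mapsto> - y\<close>, assume \<open>y \<ge> 0\<close>.
  If \<open>k \<ge> 1\<close>, every coefficient in \<open>D x' / x\<close> is nonpositive, so \<open>x' \<le> 0\<close>, whereas
  velocities in \<open>zone12 k\<close> have \<open>x > 0\<close>. If \<open>k \<le> 1\<close>, then \<open>D (k x' + y')\<close> splits into the
  part that survives for \<open>\<epsilon> = 0\<close> and a dissipative part proportional to \<open>\<epsilon>\<close>, both of which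
  factor (\<open>impact12_wall_identity\<close>) with factors of evident sign on \<open>0 \<le> y < k x\<close>.
  Hence \<open>k x' + y' \<le> 0\<close>: after the impact the disk no longer approaches the wall that it
  was approaching faster (\<open>k x + y \<ge> k x - y\<close>).
\<close>

lemma zone12_pos:
  assumes "0 < k" and "(x, y) \<in> zone12 k"
  shows "0 < x"
proof -
  have "0 < k * x"
    using assms(2) by (simp add: zone12_def)
  with \<open>0 < k\<close> show ?thesis
    by (simp add: zero_less_mult_iff)
qed

lemma zone12_mirror: "(x, - y) \<in> zone12 k \<longleftrightarrow> (x, y) \<in> zone12 k"
  by (auto simp: zone12_def)

lemma impact12_mirror:
  "impact12 e k (x, - y) = (fst (impact12 e k (x, y)), - snd (impact12 e k (x, y)))"
  by (simp add: impact12_def)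

lemma impact_step_zone12: "p \<in> zone12 k \<Longrightarrow> impact_step e k p = impact12 e k p"
  using zones_disjoint[of k] by (auto simp: impact_step_def)

text \<open>
  The left-hand side is the numerator of \<open>k x' + y'\<close>, a cubic form in \<open>u = k x\<close> and \<open>y\<close>.
  At \<open>e = 0\<close> it is divisible by \<open>u - y\<close>, which is positive in the zone, and its coefficient
  of \<open>e\<close> has only terms of one sign when \<open>u, y \<ge> 0\<close>. So for \<open>k \<le> 1\<close> both signs can be read off.
\<close>

lemma impact12_wall_identity:
  fixes e k x y :: real
  shows "k * ((- e * k^4 * x^2 + (1 - (1 + e) * k^2) * y^2) * x)
           + (k^2 * (k^2 - (1 + e)) * x^2 - e * y^2) * y
         = - ((1 - k^2) * (k * x) * y * (k * x - y))
           - e * ((k * x)^2 + y^2) * (k^2 * (k * x) + y)"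
  by algebra

text \<open>
  Only the term \<open>(1 - (1 + e) k\<^sup>2) y\<^sup>2\<close> could drive the disk further into the corner, and its
  coefficient is nonpositive once \<open>k \<ge> 1\<close>.
\<close>

lemma impact12_fst_nonpos:
  assumes "1 \<le> k" and "0 \<le> e" and "0 \<le> x"
  shows "fst (impact12 e k (x, y)) \<le> 0"
proof -
  have "1 \<le> k^2"
    using \<open>1 \<le> k\<close> by simp
  also have "k^2 \<le> (1 + e) * k^2"
    using \<open>0 \<le> e\<close> by (simp add: distrib_right)
  finally have "(1 - (1 + e) * k^2) * y^2 \<le> 0"
    by (simp add: mult_nonpos_nonneg)
  moreover have "0 \<le> e * k^4 * x^2"
    using \<open>0 \<le> e\<close> by simp
  ultimately have "- e * k^4 * x^2 + (1 - (1 + e) * k^2) * y^2 \<le> 0"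
    by simp
  then show ?thesis
    using \<open>0 \<le> x\<close> by (simp add: impact12_def mult_nonpos_nonneg divide_nonpos_nonneg)
qed

lemma impact12_leaves_wall:
  assumes "0 \<le> k" and "k \<le> 1" and "0 \<le> e" and "0 \<le> x" and "0 \<le> y" and "y \<le> k * x"
  shows "k * fst (impact12 e k (x, y)) + snd (impact12 e k (x, y)) \<le> 0"
proof -
  have "k^2 \<le> 1"
    using assms by (simp add: power_le_one)
  then have "0 \<le> (1 - k^2) * (k * x) * y * (k * x - y)"
    using assms by simp
  moreover have "0 \<le> e * ((k * x)^2 + y^2) * (k^2 * (k * x) + y)"
    using assms by simp
  ultimately have "k * ((- e * k^4 * x^2 + (1 - (1 + e) * k^2) * y^2) * x)
      + (k^2 * (k^2 - (1 + e)) * x^2 - e * y^2) * y \<le> 0" (is "?N \<le> 0")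
    unfolding impact12_wall_identity by linarith
  then have "?N / (k^4 * x^2 + y^2) \<le> 0"
    by (simp add: divide_nonpos_nonneg)
  then show ?thesis
    by (simp add: impact12_def add_divide_distrib)
qed

lemma impact12_not_zone12_upper:
  assumes "0 < k" and "0 \<le> e" and "(x, y) \<in> zone12 k" and "0 \<le> y"
  shows "impact12 e k (x, y) \<notin> zone12 k"
proof
  obtain x' y' where p: "impact12 e k (x, y) = (x', y')"
    by fastforce
  assume "impact12 e k (x, y) \<in> zone12 k"
  then have z: "(x', y') \<in> zone12 k"
    by (simp add: p)
  have "0 < x" and "y < k * x"
    using zone12_pos[OF assms(1,3)] assms(3) by (auto simp: zone12_def)
  show False
  proof (cases "1 \<le> k")
    case True
    then have "x' \<le> 0"
      using impact12_fst_nonpos[of k e x y] \<open>0 \<le> e\<close> \<open>0 < x\<close> p by simp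
    with zone12_pos[OF \<open>0 < k\<close> z] show False
      by simp
  next
    case False
    then have "k * x' + y' \<le> 0"
      using impact12_leaves_wall[of k e x y] assms \<open>0 < x\<close> \<open>y < k * x\<close> p by simp
    with z show False
      by (simp add: zone12_def)
  qed
qed

lemma impact12_not_zone12:
  assumes "0 < k" and "0 \<le> e" and "p \<in> zone12 k"
  shows "impact12 e k p \<notin> zone12 k"
proof -
  obtain x y where p: "p = (x, y)"
    by fastforce
  show ?thesis
  proof (cases "0 \<le> y")
    case True
    with impact12_not_zone12_upper assms show ?thesis
      by (simp add: p)
  next
    case False
    then have "impact12 e k (x, - y) \<notin> zone12 k"
      using assms by (intro impact12_not_zone12_upper) (simp_all add: p zone12_mirror)
    then show ?thesis
      by (simp add: p impact12_mirror zone12_mirror)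
  qed
qed

theorem theorem5p1:
  fixes \<alpha> k \<epsilon> :: real and v :: "nat \<Rightarrow> real \<times> real"
  assumes "0 < 2 * \<alpha>" and "2 * \<alpha> < pi"
    and "k = tan \<alpha>"
    and "0 \<le> \<epsilon>" and "\<epsilon> < 1"
    and "\<And>n. v (Suc n) = impact_step \<epsilon> k (v n)"
  shows "\<forall>n. v n \<in> zone12 k \<longrightarrow> v (Suc n) \<notin> zone12 k"
proof -
  have "0 < k"
    using assms(1-3) by (simp add: tan_gt_zero)
  then show ?thesis
    using assms(4,6) by (simp add: impact_step_zone12 impact12_not_zone12)
qed

end
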